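(* For any $n\geq 2$, there exists a compact, countable, relatively connected set $E\subset\mathbb{R}^n$ and a bi-Lipschitz mapping $f:E\to\mathbb{R}^n$ that admits a homeomorphic extension $\mathbb{R}^n\to\mathbb{R}^n$ but no quasisymmetric extension $\mathbb{R}^n\to\mathbb{R}^n$.
   Context: A mapping $f:E\to\mathbb{R}^n$ is bi-Lipschitz if it is a homeomorphism onto $f(E)$ and, for some $L>1$, both $f$ and $f^{-1}:f(E)\to E$ are $L$-Lipschitz. Quasisymmetry: a map $f:(X,d)\to(Y,d')$ between metric spaces, which is a homeomorphism onto its image, is quasisymmetric if there is a homeomorphism $\eta:[0,\infty)\to[0,\infty)$ such that for all $x,a,b\in X$ with $x\neq b$, $\frac{d'(f(x),f(a))}{d'(f(x),f(b))}\le\eta\left(\frac{d(x,a)}{d(x,b)}\right)$. Relative connectedness: a metric space $X$ is $M$-relatively connected, $M>1$, if for every $x\in X$ and $r>0$ with $\overline{B}(x,r)\neq X$, either $\overline{B}(x,r)=\{x\}$ or $\overline{B}(x,r)\setminus B(x,r/M)\neq\emptyset$, where $B(x,r)$ and $\overline{B}(x,r)$ are the open ball $\{d(\cdot,x)<r\}$ and the closed ball $\{d(\cdot,x)\le r\}$ in $X$. It is relatively connected if it is $M$-relatively connected for some $M$. A subset $E\subset\mathbb{R}^n$ is regarded as a metric space with the Euclidean metric. *)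

theory Defs
  imports "HOL-Analysis.Analysis"
begin

text \<open>A metric space \<open>X\<close> is represented by a subset of a type of class \<open>metric_space\<close>,
  with the restricted metric.\<close>

definition bilipschitz_on :: "'a::metric_space set \<Rightarrow> ('a \<Rightarrow> 'b::metric_space) \<Rightarrow> bool" where
  "bilipschitz_on X f \<longleftrightarrow>
     (\<exists>g. homeomorphism X (f ` X) f g \<and> (\<exists>L>1. L-lipschitz_on X f \<and> L-lipschitz_on (f ` X) g))"

text \<open>Only a homeomorphism onto the image is required; surjectivity onto the target is not.\<close>

definition quasisymmetric_on :: "'a::metric_space set \<Rightarrow> ('a \<Rightarrow> 'b::metric_space) \<Rightarrow> bool" where
  "quasisymmetric_on X f \<longleftrightarrow>
     (\<exists>g. homeomorphism X (f ` X) f g) \<and>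
     (\<exists>\<eta> \<theta> :: real \<Rightarrow> real. homeomorphism {0..} {0..} \<eta> \<theta> \<and>
        (\<forall>x\<in>X. \<forall>a\<in>X. \<forall>b\<in>X. x \<noteq> b \<longrightarrow>
           dist (f x) (f a) / dist (f x) (f b) \<le> \<eta> (dist x a / dist x b)))"

text \<open>The balls of the metric space \<open>X\<close> are the traces on \<open>X\<close> of the ambient balls.\<close>

definition M_relatively_connected :: "real \<Rightarrow> 'a::metric_space set \<Rightarrow> bool" where
  "M_relatively_connected M X \<longleftrightarrow>
     M > 1 \<and>
     (\<forall>x\<in>X. \<forall>r>0. cball x r \<inter> X \<noteq> X \<longrightarrow>
        cball x r \<inter> X = {x} \<or> (cball x r \<inter> X) - (ball x (r / M) \<inter> X) \<noteq> {})"

definition relatively_connected :: "'a::metric_space set \<Rightarrow> bool" where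
  "relatively_connected X \<longleftrightarrow> (\<exists>M. M_relatively_connected M X)"

end

theory Submission
  imports Defs
begin

text \<open>
  Fix a unit vector \<open>e\<close> and put \<open>s k = (1/8) ^ k\<close>. At scale \<open>k\<close> consider the sphere of radius
  \<open>s k / 4\<close> around \<open>p k = s k *\<^sub>R e\<close>, a finite net \<open>N k\<close> of it that is separated by
  \<open>s k / (k + 1)\<close> and dense up to twice that distance, and the point \<open>q k = (3/2 * s k) *\<^sub>R e\<close> outside the sphere. The set \<open>E\<close> consists of
  the origin and of all \<open>p k\<close>, \<open>q k\<close> and \<open>N k\<close>, and the map fixes the nets and exchanges every
  \<open>p k\<close> with \<open>q k\<close>.

  The map is bi-Lipschitz on \<open>E\<close>, because a moved point moves by \<open>s k / 2\<close> while the rest of \<open>E\<close>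
  stays at distance at least \<open>s k / 4\<close> from it. It extends to a homeomorphism, because in dimension
  at least two a ball minus a finite set is connected, so \<open>p k\<close> and \<open>q k\<close> can be exchanged by a
  homeomorphism that is supported in a small ball and fixes \<open>N k\<close>; the supports for different \<open>k\<close>
  are disjoint and shrink, so these homeomorphisms can be glued
  (\<open>glue_disjointly_supported_homeomorphisms\<close>). The set \<open>E\<close> is relatively connected even though the
  meshes degenerate relative to the scale: a net imitates the connected sphere down to
  the size of the mesh, and below that size its points are isolated.

  A quasisymmetric extension \<open>F\<close> would have one gauge \<open>\<eta>\<close> for all scales. As the relative mesh
  \<open>1 / (k + 1)\<close> tends to zero, \<open>\<eta>\<close> forces \<open>F\<close> to be, relative to the scale, uniformly close to the
  identity on the whole \<open>k\<close>-th sphere. For large \<open>k\<close> the ray from \<open>q k\<close> to infinity then misses the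
  image of the sphere. But \<open>F\<close> sends \<open>p k\<close>, a point enclosed by the sphere, to \<open>q k\<close>, and an
  embedding of a ball cannot send an interior point to a point that can be joined to infinity
  off the image of the boundary (\<open>unbounded_connected_avoids_embedded_image\<close>).
\<close>

section \<open>Separated nets\<close>

text \<open>Greedy selection: a point is added unless it is close to one that was already selected.\<close>

lemma finite_separated_subset:
  fixes K :: "'a::metric_space set"
  assumes "finite K" "0 < \<epsilon>"
  shows "\<exists>N\<subseteq>K. pairwise (\<lambda>x y. \<epsilon> \<le> dist x y) N \<and> (\<forall>x\<in>K. \<exists>y\<in>N. dist x y \<le> \<epsilon>)"
  using assms(1)
proof (induction K)
  case empty
  show ?case by auto
next
  case (insert a K)
  then obtain N where N: "N \<subseteq> K" "pairwise (\<lambda>x y. \<epsilon> \<le> dist x y) N"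
    "\<forall>x\<in>K. \<exists>y\<in>N. dist x y \<le> \<epsilon>"
    by blast
  show ?case
  proof (cases "\<exists>y\<in>N. dist a y \<le> \<epsilon>")
    case True
    with N show ?thesis by (intro exI[of _ N]) auto
  next
    case False
    then have "\<forall>y\<in>N. \<epsilon> \<le> dist a y \<and> \<epsilon> \<le> dist y a"
      by (auto simp: dist_commute)
    with N have "pairwise (\<lambda>x y. \<epsilon> \<le> dist x y) (insert a N)"
      by (auto simp: pairwise_insert)
    moreover have "\<forall>x\<in>insert a K. \<exists>y\<in>insert a N. dist x y \<le> \<epsilon>"
      using N(3) assms(2) by auto
    ultimately show ?thesis
      using N(1) by (intro exI[of _ "insert a N"]) auto
  qed
qed

text \<open>The net is selected from the centres of a finite cover by balls of radius \<open>\<epsilon>\<close>. A rejected centre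
  lies within \<open>\<epsilon>\<close> of a selected one, which costs the factor two in the density.\<close>

lemma compact_separated_net:
  fixes S :: "'a::metric_space set"
  assumes "compact S" "0 < \<epsilon>"
  shows "\<exists>N. finite N \<and> N \<subseteq> S \<and> pairwise (\<lambda>x y. \<epsilon> \<le> dist x y) N \<and>
             (\<forall>x\<in>S. \<exists>y\<in>N. dist x y \<le> 2 * \<epsilon>)"
proof -
  obtain K where K: "finite K" "K \<subseteq> S" "S \<subseteq> (\<Union>x\<in>K. ball x \<epsilon>)"
    using assms seq_compact_imp_totally_bounded[of S] by (auto simp: compact_eq_seq_compact_metric)
  obtain N where N: "N \<subseteq> K" "pairwise (\<lambda>x y. \<epsilon> \<le> dist x y) N" "\<forall>x\<in>K. \<exists>y\<in>N. dist x y \<le> \<epsilon>"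
    using finite_separated_subset[OF K(1) \<open>0 < \<epsilon>\<close>] by blast
  have "\<exists>y\<in>N. dist x y \<le> 2 * \<epsilon>" if xS: "x \<in> S" for x
  proof -
    obtain z where z: "z \<in> K" "dist z x < \<epsilon>"
      using K(3) xS by auto
    obtain y where y: "y \<in> N" "dist z y \<le> \<epsilon>"
      using N(3) z by blast
    have "dist x y \<le> 2 * \<epsilon>"
      using z y dist_triangle2[of x y z] dist_commute[of z x] dist_triangle[of x y z] by linarith
    with y show ?thesis by blast
  qed
  with N K show ?thesis
    by (meson finite_subset order_trans)
qed

section \<open>Metric and topological preliminaries\<close>

lemma compact_if_finite_outside_balls:
  fixes E :: "'a::metric_space set"
  assumes "a \<in> E" and fin: "\<And>r. 0 < r \<Longrightarrow> finite (E - ball a r)"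
  shows "compact E"
proof (rule compactI)
  fix \<C> :: "'a set set"
  assume op: "\<forall>U\<in>\<C>. open U" and cov: "E \<subseteq> \<Union>\<C>"
  obtain U where U: "U \<in> \<C>" "a \<in> U"
    using assms(1) cov by blast
  obtain r where r: "0 < r" "ball a r \<subseteq> U"
    using U op open_contains_ball by blast
  have "\<forall>x\<in>E - ball a r. \<exists>V\<in>\<C>. x \<in> V"
    using cov by blast
  then obtain V where V: "\<forall>x\<in>E - ball a r. V x \<in> \<C> \<and> x \<in> V x"
    by metis
  show "\<exists>\<D>\<subseteq>\<C>. finite \<D> \<and> E \<subseteq> \<Union>\<D>"
  proof (intro exI conjI)
    show "insert U (V ` (E - ball a r)) \<subseteq> \<C>" using U V by blast
    show "finite (insert U (V ` (E - ball a r)))" using fin[OF r(1)] by simp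
    show "E \<subseteq> \<Union>(insert U (V ` (E - ball a r)))" using r V by blast
  qed
qed

text \<open>Two distinct points can both move, which gives the factor two.\<close>

lemma lipschitz_on_small_displacement:
  fixes f :: "'a::metric_space \<Rightarrow> 'a"
  assumes "0 \<le> A"
    and disp: "\<And>x y. x \<in> X \<Longrightarrow> y \<in> X \<Longrightarrow> x \<noteq> y \<Longrightarrow> dist (f x) x \<le> A * dist x y"
  shows "(1 + 2 * A)-lipschitz_on X f"
proof (rule lipschitz_onI)
  fix x y assume xy: "x \<in> X" "y \<in> X"
  show "dist (f x) (f y) \<le> (1 + 2 * A) * dist x y"
  proof (cases "x = y")
    case False
    have "dist (f x) (f y) \<le> dist (f x) x + dist x y + dist y (f y)"
      using dist_triangle[of "f x" "f y" x] dist_triangle[of x "f y" y] by linarith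
    also have "\<dots> \<le> A * dist x y + dist x y + A * dist x y"
      using disp[of x y] disp[of y x] xy False by (simp add: dist_commute)
    finally show ?thesis by (simp add: algebra_simps)
  qed simp
qed (use assms in simp)

lemma zero_of_homeomorphism_half_line:
  fixes \<eta> \<theta> :: "real \<Rightarrow> real"
  assumes hom: "homeomorphism {0..} {0..} \<eta> \<theta>"
  shows "\<eta> 0 = 0"
proof -
  have img: "\<eta> ` {0..} = {0..}" and cont: "continuous_on {0..} \<eta>"
    using hom by (auto simp: homeomorphism_def)
  have "inj_on \<eta> {0..}"
    using hom unfolding homeomorphism_def by (intro inj_on_inverseI[of _ \<theta>]) auto
  then consider "strict_mono_on {0..} \<eta>" | "strict_antimono_on {0..} \<eta>"
    using injective_eq_monotone_map[OF _ cont] by (auto simp: is_interval_ci)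
  then show ?thesis
  proof cases
    case 1
    obtain a where a: "0 \<le> a" "\<eta> a = 0"
      using img by (metis atLeast_iff imageE order_refl)
    have "\<eta> 0 \<ge> 0" using img by auto
    then show ?thesis
      using a 1 unfolding monotone_on_def by (metis atLeast_iff less_eq_real_def not_less)
  next
    case 2
    have "\<eta> 0 \<ge> 0" using img by auto
    \<comment> \<open>A decreasing map would be bounded above by its value at \<open>0\<close>.\<close>
    then have "\<eta> 0 + 1 \<in> \<eta> ` {0..}" using img by auto
    then obtain a where a: "0 \<le> a" "\<eta> a = \<eta> 0 + 1" by auto
    then have "a \<noteq> 0" by auto
    then have "\<eta> a < \<eta> 0" using a monotone_onD[OF 2, of 0 a] by simp
    with a show ?thesis by simp
  qed
qed

text \<open>By invariance of domain, the frontier of the compact set \<open>F ` closure U\<close> lies in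
  \<open>F ` frontier U\<close>. A connected set that meets the compact set without crossing this frontier is
  trapped in it, hence bounded.\<close>

lemma unbounded_connected_avoids_embedded_image:
  fixes F :: "'a::euclidean_space \<Rightarrow> 'a"
  assumes U: "open U" "bounded U"
    and F: "continuous_on (closure U) F" "inj_on F (closure U)"
    and C: "connected C" "\<not> bounded C" "C \<inter> F ` frontier U = {}"
  shows "C \<inter> F ` closure U = {}"
proof (rule ccontr)
  assume meets: "C \<inter> F ` closure U \<noteq> {}"
  have comp: "compact (F ` closure U)"
    using U F by (intro compact_continuous_image) auto
  then have "C - F ` closure U \<noteq> {}"
    using C(2) bounded_subset[OF compact_imp_bounded[OF comp], of C] by blast
  with meets C(1) have "C \<inter> frontier (F ` closure U) \<noteq> {}"
    by (intro connected_Int_frontier) auto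
  moreover have "open (F ` U)"
    using U F closure_subset by (metis continuous_on_subset inj_on_subset invariance_of_domain)
  then have "F ` U \<subseteq> interior (F ` closure U)"
    by (simp add: closure_subset image_mono interior_maximal)
  then have "frontier (F ` closure U) \<subseteq> F ` frontier U"
    using comp U unfolding frontier_def by (auto simp: compact_imp_closed interior_open)
  ultimately show False using C(3) by blast
qed

section \<open>Gluing homeomorphisms with disjoint supports\<close>

text \<open>The displacements of the given maps are summed. At every point at most one summand is nonzero,
  so the sum acts on each \<open>B k\<close> as \<open>h k\<close>; summability of the radii makes the series uniformly
  convergent, which is what gives continuity where the supports accumulate.\<close>

lemma glue_disjointly_supported_maps:
  fixes h :: "nat \<Rightarrow> 'a::euclidean_space \<Rightarrow> 'a"
  assumes cont: "\<And>k. continuous_on UNIV (h k)"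
    and supp: "\<And>k x. x \<notin> B k \<Longrightarrow> h k x = x"
    and maps: "\<And>k x. x \<in> B k \<Longrightarrow> h k x \<in> B k"
    and disj: "\<And>j k x. x \<in> B j \<Longrightarrow> x \<in> B k \<Longrightarrow> j = k"
    and ball: "\<And>k. B k \<subseteq> ball (c k) (r k)" "\<And>k. 0 \<le> r k" "summable r"
  shows "\<exists>F. continuous_on UNIV F \<and> (\<forall>k. \<forall>x\<in>B k. F x = h k x) \<and> (\<forall>x. x \<notin> (\<Union>k. B k) \<longrightarrow> F x = x)"
proof -
  define F where "F x = x + (\<Sum>k. h k x - x)" for x
  have bound: "norm (h k x - x) \<le> 2 * r k" for k x
  proof (cases "x \<in> B k")
    case True
    then have "dist (c k) x < r k" "dist (c k) (h k x) < r k"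
      using ball maps by (auto simp: subset_iff)
    then show ?thesis
      using dist_triangle3[of "h k x" x "c k"] by (simp add: dist_norm)
  qed (use supp ball in simp)
  have "uniform_limit UNIV (\<lambda>n x. \<Sum>k<n. h k x - x) (\<lambda>x. \<Sum>k. h k x - x) sequentially"
    by (rule Weierstrass_m_test[where M = "\<lambda>k. 2 * r k"]) (use bound ball in auto)
  then have "continuous_on UNIV (\<lambda>x. \<Sum>k. h k x - x)"
    by (rule uniform_limit_theorem[rotated])
       (auto intro!: always_eventually continuous_intros cont)
  then have "continuous_on UNIV F"
    unfolding F_def by (intro continuous_intros)
  moreover have "F x = h k x" if "x \<in> B k" for k x
  proof -
    have "h j x - x = 0" if "j \<notin> {k}" for j
      using disj[of x j k] \<open>x \<in> B k\<close> supp[of x j] that by auto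
    then have "(\<Sum>j. h j x - x) = (\<Sum>j\<in>{k}. h j x - x)"
      by (intro suminf_finite) auto
    then show "F x = h k x" unfolding F_def by simp
  qed
  moreover have "F x = x" if "x \<notin> (\<Union>k. B k)" for x
    using that supp unfolding F_def by simp
  ultimately show ?thesis by blast
qed

lemma glue_disjointly_supported_homeomorphisms:
  fixes h g :: "nat \<Rightarrow> 'a::euclidean_space \<Rightarrow> 'a"
  assumes hom: "\<And>k. homeomorphism UNIV UNIV (h k) (g k)"
    and supp: "\<And>k x. x \<notin> B k \<Longrightarrow> h k x = x"
    and disj: "\<And>j k x. x \<in> B j \<Longrightarrow> x \<in> B k \<Longrightarrow> j = k"
    and ball: "\<And>k. B k \<subseteq> ball (c k) (r k)" "\<And>k. 0 \<le> r k" "summable r"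
  shows "\<exists>F G. homeomorphism UNIV UNIV F G \<and>
           (\<forall>k. \<forall>x\<in>B k. F x = h k x) \<and> (\<forall>x. x \<notin> (\<Union>k. B k) \<longrightarrow> F x = x)"
proof -
  have gh: "g k (h k x) = x" and hg: "h k (g k x) = x" for k x
    using hom[of k] by (auto simp: homeomorphism_def)
  have cont: "continuous_on UNIV (h k)" "continuous_on UNIV (g k)" for k
    using hom[of k] by (auto simp: homeomorphism_def)
  have supp_g: "g k x = x" if "x \<notin> B k" for k x
    using supp[OF that] gh by metis
  have maps: "h k x \<in> B k" "g k x \<in> B k" if "x \<in> B k" for k x
    using supp supp_g gh hg that by metis+
  have "\<exists>F. continuous_on UNIV F \<and> (\<forall>k. \<forall>x\<in>B k. F x = h k x) \<and> (\<forall>x. x \<notin> (\<Union>k. B k) \<longrightarrow> F x = x)"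
    by (rule glue_disjointly_supported_maps[where c = c and r = r])
       (fact cont supp maps disj ball)+
  then obtain F where F: "continuous_on UNIV F" "\<And>k x. x \<in> B k \<Longrightarrow> F x = h k x"
    "\<And>x. x \<notin> (\<Union>k. B k) \<Longrightarrow> F x = x"
    by blast
  have "\<exists>G. continuous_on UNIV G \<and> (\<forall>k. \<forall>x\<in>B k. G x = g k x) \<and> (\<forall>x. x \<notin> (\<Union>k. B k) \<longrightarrow> G x = x)"
    by (rule glue_disjointly_supported_maps[where c = c and r = r])
       (fact cont supp_g maps disj ball)+
  then obtain G where G: "continuous_on UNIV G" "\<And>k x. x \<in> B k \<Longrightarrow> G x = g k x"
    "\<And>x. x \<notin> (\<Union>k. B k) \<Longrightarrow> G x = x"
    by blast
  have "G (F x) = x \<and> F (G x) = x" for x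
  proof (cases "\<exists>k. x \<in> B k")
    case True
    then obtain k where k: "x \<in> B k" by blast
    then show ?thesis
      using F(2) G(2) maps[OF k] gh hg by metis
  next
    case False
    then show ?thesis using F(3) G(3) by simp
  qed
  then have "homeomorphism UNIV UNIV F G"
    using F(1) G(1) by (intro homeomorphismI) auto
  then show ?thesis using F(2,3) by blast
qed

lemma homeomorphism_swap_exists:
  fixes a b :: "'a::euclidean_space"
  assumes "2 \<le> DIM('a)" "open S" "connected S" "a \<in> S" "b \<in> S" "a \<noteq> b"
  shows "\<exists>h g. homeomorphism UNIV UNIV h g \<and> h a = b \<and> h b = a \<and> (\<forall>x. x \<notin> S \<longrightarrow> h x = x)"
proof -
  have aff: "UNIV \<subseteq> affine hull S"
    using assms affine_hull_open by blast
  define x where "x i = (if i then a else b)" for i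
  define y where "y i = (if i then b else a)" for i
  have xy: "\<And>i. i \<in> UNIV \<Longrightarrow> x i \<in> S \<and> y i \<in> S"
    and pw: "pairwise (\<lambda>i j. x i \<noteq> x j \<and> y i \<noteq> y j) UNIV"
    using assms by (auto simp: x_def y_def pairwise_def)
  obtain h g where hg: "homeomorphism UNIV UNIV h g" "\<And>i. i \<in> UNIV \<Longrightarrow> h (x i) = y i"
    "{x. \<not> (h x = x \<and> g x = x)} \<subseteq> S"
    by (rule homeomorphism_moving_points_exists[OF assms(1-3) subset_UNIV finite xy pw subset_UNIV
          aff assms(3)]) (simp, rule that)
  have "h a = b" "h b = a"
    using hg(2)[of True] hg(2)[of False] by (auto simp: x_def y_def)
  moreover have "h z = z" if "z \<notin> S" for z
    using hg(3) that by auto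
  ultimately show ?thesis using hg(1) by blast
qed

section \<open>The set and the swaps\<close>

text \<open>The nets come from a choice, so they enter as parameters with their defining properties.\<close>

locale netted_spheres =
  fixes e :: "'a::euclidean_space" and s mesh :: "nat \<Rightarrow> real" and N :: "nat \<Rightarrow> 'a set"
  assumes dim: "2 \<le> DIM('a)" and norm_e: "norm e = 1"
    and s_def: "\<And>k. s k = (1/8) ^ k"
    and mesh_def: "\<And>k. mesh k = s k / (k + 1)"
    and finite_N: "\<And>k. finite (N k)"
    and N_sphere: "\<And>k. N k \<subseteq> sphere (s k *\<^sub>R e) (s k / 4)"
    and N_separated: "\<And>k. pairwise (\<lambda>x y. mesh k \<le> dist x y) (N k)"
    and N_dense: "\<And>k x. x \<in> sphere (s k *\<^sub>R e) (s k / 4) \<Longrightarrow> \<exists>y\<in>N k. dist x y \<le> 2 * mesh k"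
begin

definition p :: "nat \<Rightarrow> 'a" where "p k = s k *\<^sub>R e"
definition q :: "nat \<Rightarrow> 'a" where "q k = (3/2 * s k) *\<^sub>R e"
definition T :: "nat \<Rightarrow> 'a set" where "T k = insert (p k) (insert (q k) (N k))"
definition E :: "'a set" where "E = insert 0 (\<Union>k. T k)"

lemma s_pos: "0 < s k"
  by (simp add: s_def)

lemma mesh_pos: "0 < mesh k"
  by (simp add: mesh_def s_pos)

lemma s_mono: "j < k \<Longrightarrow> 8 * s k \<le> s j"
proof -
  assume "j < k"
  then have "(1/8::real) ^ k \<le> (1/8) ^ Suc j"
    by (intro power_decreasing) auto
  then show ?thesis by (simp add: s_def)
qed

lemma norm_p: "norm (p k) = s k" and norm_q: "norm (q k) = 3/2 * s k"
  using s_pos[of k] by (simp_all add: p_def q_def norm_e)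

lemma dist_p_q: "dist (p k) (q k) = s k / 2"
proof -
  have "p k - q k = (- s k / 2) *\<^sub>R e"
    unfolding p_def q_def by (simp add: algebra_simps flip: scaleR_left_diff_distrib)
  then show ?thesis using s_pos[of k] by (simp add: dist_norm norm_e)
qed

lemma dist_p_N: "x \<in> N k \<Longrightarrow> dist (p k) x = s k / 4"
  using N_sphere[of k] by (auto simp: p_def)

lemma dist_q_N: "x \<in> N k \<Longrightarrow> s k / 4 \<le> dist (q k) x"
  using dist_p_N[of x k] dist_p_q[of k] dist_triangle[of "p k" "q k" x] by (simp add: dist_commute)

lemma norm_T: "x \<in> T k \<Longrightarrow> 3/4 * s k \<le> norm x \<and> norm x \<le> 3/2 * s k"
  using norm_p[of k] norm_q[of k] s_pos[of k] dist_p_N[of x k]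
    norm_triangle_ineq2[of "p k" x] norm_triangle_ineq2[of x "p k"]
  by (auto simp: T_def dist_norm norm_minus_commute)

text \<open>The ratio 1/8 of consecutive scales keeps the norms of different \<open>T k\<close> apart.\<close>

lemma dist_other_scale:
  assumes "x \<in> T k" "y \<in> E" "y \<notin> T k"
  shows "s k / 4 \<le> dist x y"
proof -
  have *: "\<bar>norm x - norm y\<bar> \<le> dist x y"
    by (simp add: dist_norm norm_triangle_ineq3)
  note x = norm_T[OF assms(1)]
  consider "y = 0" | j where "y \<in> T j" "j < k" | j where "y \<in> T j" "k < j"
    using assms by (auto simp: E_def) (metis linorder_neqE_nat)
  then show ?thesis
  proof cases
    case 1
    then show ?thesis using x s_pos[of k] by simp
  next
    case 2
    then show ?thesis using norm_T[of y j] s_mono[of j k] x s_pos[of k] * by linarith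
  next
    case 3
    then show ?thesis using norm_T[of y j] s_mono[of k j] x s_pos[of k] * by linarith
  qed
qed

lemma isolated_p_q:
  assumes "x = p k \<or> x = q k" "y \<in> E" "y \<noteq> x"
  shows "s k / 4 \<le> dist x y"
proof (cases "y \<in> T k")
  case True
  then show ?thesis
    using assms dist_p_q[of k] dist_p_N[of y k] dist_q_N[of y k] s_pos[of k]
    by (auto simp: T_def dist_commute)
next
  case False
  then show ?thesis using assms dist_other_scale[of x k y] by (auto simp: T_def)
qed

lemma isolated_N:
  assumes "x \<in> N k" "y \<in> E" "y \<noteq> x"
  shows "mesh k / 4 \<le> dist x y"
proof -
  have le: "mesh k \<le> s k"
    using s_pos[of k] by (simp add: mesh_def field_simps)
  show ?thesis
  proof (cases "y \<in> N k")
    case True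
    then have "mesh k \<le> dist x y"
      using N_separated[of k] assms by (auto simp: pairwise_def)
    with mesh_pos[of k] show ?thesis by linarith
  next
    case False
    have "s k / 4 \<le> dist x y"
    proof (cases "y = p k \<or> y = q k")
      case True
      then show ?thesis
        using isolated_p_q[of y k x] assms by (auto simp: dist_commute E_def T_def)
    next
      case other: False
      then show ?thesis
        using dist_other_scale[of x k y] assms False by (auto simp: T_def)
    qed
    with le show ?thesis by linarith
  qed
qed

lemma countable_E: "countable E"
  using finite_N by (auto simp: E_def T_def intro: countable_finite)

lemma compact_E: "compact E"
proof (rule compact_if_finite_outside_balls[of 0])
  fix r :: real assume "0 < r"
  then obtain n where n: "(1/8::real) ^ n < r / 2"
    using real_arch_pow_inv[of "r / 2" "1/8"] by auto
  have "E - ball 0 r \<subseteq> (\<Union>k\<in>{..n}. T k)"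
  proof
    fix x assume x: "x \<in> E - ball 0 r"
    then obtain k where k: "x \<in> T k"
      using \<open>0 < r\<close> by (auto simp: E_def)
    have "k \<le> n"
    proof (rule ccontr)
      assume "\<not> k \<le> n"
      then have "8 * s k \<le> s n" using s_mono by simp
      then show False
        using norm_T[OF k] x n s_pos[of k] by (auto simp: s_def)
    qed
    with k show "x \<in> (\<Union>k\<in>{..n}. T k)" by blast
  qed
  then show "finite (E - ball 0 r)"
    by (rule finite_subset) (auto simp: T_def finite_N)
qed (simp add: E_def)

text \<open>If \<open>r\<close> is comparable with \<open>norm x\<close>, the origin lies in the annulus. If \<open>r\<close> is much larger, then \<open>x\<close>
  is practically the origin and some \<open>p j\<close> lies in the annulus: the norms of consecutive \<open>p j\<close> differ
  by the factor 8, so one of them lies between \<open>r / 16\<close> and \<open>r / 2\<close>.\<close>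

lemma annulus_point_large:
  assumes x: "x \<in> E" "norm x \<le> r" and r: "0 < r" "r \<le> 4"
  shows "\<exists>z\<in>E. r / 64 \<le> dist x z \<and> dist x z \<le> r"
proof (cases "norm x \<le> r / 32")
  case False
  then show ?thesis using x r by (intro bexI[of _ 0]) (auto simp: E_def)
next
  case True
  obtain n where n: "s n \<le> r / 2"
    using real_arch_pow_inv[of "r / 2" "1/8"] r by (auto simp: s_def intro: less_imp_le)
  define j where "j = (LEAST n. s n \<le> r / 2)"
  have j: "s j \<le> r / 2"
    unfolding j_def using n by (rule LeastI)
  have "r / 16 \<le> s j"
  proof (cases j)
    case 0
    then show ?thesis using r by (simp add: s_def)
  next
    case (Suc i)
    then have "\<not> s i \<le> r / 2"
      unfolding j_def using not_less_Least by (metis lessI)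
    then show ?thesis using Suc by (simp add: s_def)
  qed
  moreover have "norm (p j) - norm x \<le> dist x (p j)" "dist x (p j) \<le> norm (p j) + norm x"
    using norm_triangle_ineq2[of "p j" x] norm_triangle_ineq4[of x "p j"]
    by (auto simp: dist_norm norm_minus_commute)
  ultimately show ?thesis
    using True j r norm_p[of j] by (intro bexI[of _ "p j"]) (auto simp: E_def T_def)
qed

text \<open>The connected sphere contains a point at distance \<open>r / 3\<close> from \<open>x\<close>, because \<open>r / 3\<close> is below its
  diameter \<open>s k / 2\<close>. When \<open>r\<close> is large compared with the mesh, a net point close to that one
  remains in the annulus.\<close>

lemma annulus_point_N:
  assumes x: "x \<in> N k" and r: "mesh k < r / 16" "r \<le> 5/4 * s k"
  shows "\<exists>z\<in>E. r / 64 \<le> dist x z \<and> dist x z \<le> r"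
proof -
  let ?S = "sphere (s k *\<^sub>R e) (s k / 4)"
  have xS: "x \<in> ?S" using x N_sphere by blast
  let ?x' = "2 *\<^sub>R (s k *\<^sub>R e) - x"
  have "s k *\<^sub>R e - ?x' = x - s k *\<^sub>R e"
    unfolding scaleR_2 by simp
  then have "dist (s k *\<^sub>R e) ?x' = dist (s k *\<^sub>R e) x"
    by (simp only: dist_norm norm_minus_commute)
  then have x'S: "?x' \<in> ?S"
    using xS by (simp only: mem_sphere)
  have far: "dist x ?x' = s k / 2"
  proof -
    have "x - ?x' = 2 *\<^sub>R (x - s k *\<^sub>R e)"
      by (simp add: algebra_simps scaleR_2)
    then show ?thesis
      using xS by (simp add: dist_norm norm_minus_commute)
  qed
  have "0 < r" using r mesh_pos[of k] by linarith
  have "connected (dist x ` ?S)"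
    by (intro connected_continuous_image continuous_intros connected_sphere dim)
  moreover have "0 \<in> dist x ` ?S" "s k / 2 \<in> dist x ` ?S"
    using xS x'S far by (metis dist_self image_eqI) (metis x'S far image_eqI)
  ultimately have "r / 3 \<in> dist x ` ?S"
    using r s_pos[of k] \<open>0 < r\<close> connectedD_interval[of "dist x ` ?S" 0 "s k / 2" "r / 3"] by auto
  then obtain u where u: "u \<in> ?S" "dist x u = r / 3" by auto
  then obtain z where z: "z \<in> N k" "dist u z \<le> 2 * mesh k"
    using N_dense by blast
  have "r / 64 \<le> dist x z \<and> dist x z \<le> r"
    using u z r dist_triangle[of x u z] dist_triangle[of x z u] \<open>0 < r\<close>
    by (simp add: dist_commute)
  with z show ?thesis by (auto simp: E_def T_def)
qed

lemma relatively_connected_E: "relatively_connected E"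
  unfolding relatively_connected_def
proof
  have E_bounded: "norm x \<le> 3/2" if xE: "x \<in> E" for x
  proof (cases "x = 0")
    case False
    then obtain k where "x \<in> T k" using xE by (auto simp: E_def)
    moreover have "s k \<le> 1" by (simp add: s_def power_le_one)
    ultimately show ?thesis using norm_T[of x k] by linarith
  qed simp
  show "M_relatively_connected 64 E"
    unfolding M_relatively_connected_def
  proof (intro conjI ballI allI impI)
    fix x and r :: real
    assume x: "x \<in> E" and r: "0 < r" "cball x r \<inter> E \<noteq> E"
    obtain w where "w \<in> E" "r < dist x w"
      using r(2) by force
    then have r4: "r \<le> 4"
      using E_bounded[OF x] E_bounded[of w] norm_triangle_ineq4[of x w] by (simp add: dist_norm)
    have "\<exists>z\<in>E. r / 64 \<le> dist x z \<and> dist x z \<le> r" if not_iso: "cball x r \<inter> E \<noteq> {x}"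
    proof (cases "norm x \<le> r")
      case True
      then show ?thesis using annulus_point_large x r r4 by blast
    next
      case False
      obtain y where y: "y \<in> E" "y \<noteq> x" "dist x y \<le> r"
        using not_iso x r(1) by force
      obtain k where k: "x \<in> T k"
        using x False r(1) by (auto simp: E_def)
      note nx = norm_T[OF k]
      consider "x = p k \<or> x = q k" | "x \<in> N k" "r / 16 \<le> mesh k"
        | "x \<in> N k" "mesh k < r / 16"
        using k unfolding T_def by fastforce
      then show ?thesis
      proof cases
        case 1
        then have "r / 64 \<le> dist x y"
          using isolated_p_q[OF 1 y(1,2)] nx False r(1) by linarith
        with y show ?thesis by blast
      next
        case 2
        then have "r / 64 \<le> dist x y"
          using isolated_N[OF 2(1) y(1,2)] by linarith
        with y show ?thesis by blast
      next
        case 3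
        have "norm x \<le> 5/4 * s k"
          using norm_triangle_ineq2[of x "p k"] norm_p[of k] dist_p_N[OF 3(1)]
          by (simp add: dist_norm norm_minus_commute)
        then show ?thesis
          using annulus_point_N[OF 3] False by linarith
      qed
    qed
    then show "cball x r \<inter> E = {x} \<or> cball x r \<inter> E - ball x (r / 64) \<inter> E \<noteq> {}"
      by force
  qed simp
qed

text \<open>The map is an involution of \<open>E\<close>, so one Lipschitz bound serves both directions.\<close>

lemma bilipschitz_on_swaps:
  assumes F: "F 0 = 0" "\<And>k. F (p k) = q k" "\<And>k. F (q k) = p k" "\<And>k x. x \<in> N k \<Longrightarrow> F x = x"
  shows "bilipschitz_on E F"
proof -
  have FF: "F (F x) = x" and FE: "F x \<in> E" if "x \<in> E" for x
    using that F by (auto simp: E_def T_def)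
  have img: "F ` E = E"
    using FF FE by (metis image_eqI image_subsetI subsetI subset_antisym)
  have "dist (F x) x \<le> 2 * dist x y" if xy: "x \<in> E" "y \<in> E" "x \<noteq> y" for x y
  proof (cases "F x = x")
    case False
    then obtain k where k: "x = p k \<or> x = q k"
      using xy(1) F by (auto simp: E_def T_def)
    then have "dist (F x) x = s k / 2"
      using F dist_p_q by (auto simp: dist_commute)
    then show ?thesis
      using isolated_p_q[OF k, of y] xy by auto
  qed simp
  then have lip: "(1 + 2 * 2)-lipschitz_on E F"
    by (intro lipschitz_on_small_displacement) auto
  then have "homeomorphism E (F ` E) F F"
    using FF img by (intro homeomorphismI) (auto intro: lipschitz_on_continuous_on)
  then show ?thesis
    unfolding bilipschitz_on_def using lip img by (intro exI[of _ F] conjI exI[of _ "1 + 2 * 2"]) auto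
qed

text \<open>The supporting ball around \<open>p k\<close> must contain \<open>q k\<close>, at distance \<open>s k / 2\<close>, and still be disjoint from
  those of the other scales; radius \<open>3/4 * s k\<close> achieves both.\<close>

lemma homeomorphism_swaps_exists:
  "\<exists>F G. homeomorphism UNIV UNIV F G \<and> F 0 = 0 \<and> (\<forall>k. F (p k) = q k \<and> F (q k) = p k) \<and>
         (\<forall>k. \<forall>x\<in>N k. F x = x)"
proof -
  define B where "B k = ball (p k) (3/4 * s k)" for k
  have disj: "j = k" if "x \<in> B j" "x \<in> B k" for j k x
  proof -
    have nB: "1/4 * s k < norm x \<and> norm x < 7/4 * s k" if "x \<in> B k" for k
      using that norm_triangle_ineq2[of "p k" x] norm_triangle_ineq2[of x "p k"] norm_p[of k]
      by (auto simp: B_def dist_norm norm_minus_commute)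
    show ?thesis
      using nB[OF that(1)] nB[OF that(2)] s_mono[of j k] s_mono[of k j] s_pos[of j] s_pos[of k]
      by (cases j k rule: linorder_cases) linarith+
  qed
  have pq: "p k \<in> B k - N k" "q k \<in> B k - N k" "p k \<noteq> q k" for k
    using dist_p_q[of k] dist_p_N[of "p k" k] dist_q_N[of "q k" k] s_pos[of k]
    by (auto simp: B_def)
  have "open (B k - N k)" "connected (B k - N k)" for k
    using dim finite_N[of k]
    by (auto simp: B_def intro!: connected_open_delete_finite open_Diff finite_imp_closed)
  then have "\<forall>k. \<exists>h g. homeomorphism UNIV UNIV h g \<and> h (p k) = q k \<and> h (q k) = p k \<and>
      (\<forall>x. x \<notin> B k - N k \<longrightarrow> h x = x)"
    using homeomorphism_swap_exists[OF dim] pq by blast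
  then obtain h g where hg: "\<And>k. homeomorphism UNIV UNIV (h k) (g k)"
    "\<And>k. h k (p k) = q k" "\<And>k. h k (q k) = p k" "\<And>k x. x \<notin> B k - N k \<Longrightarrow> h k x = x"
    by metis
  have "summable (\<lambda>k. 3/4 * s k)"
    by (simp add: s_def summable_geometric)
  then obtain F G where FG: "homeomorphism UNIV UNIV F G"
    "\<And>k x. x \<in> B k \<Longrightarrow> F x = h k x" "\<And>x. x \<notin> (\<Union>k. B k) \<Longrightarrow> F x = x"
    using glue_disjointly_supported_homeomorphisms[of h g B p "\<lambda>k. 3/4 * s k"] hg disj s_pos
    by (auto simp: B_def less_imp_le)
  have "0 \<notin> B k" for k
    using norm_p[of k] s_pos[of k] by (simp add: B_def)
  then have "F 0 = 0" using FG(3) by simp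
  moreover have "F x = x" if "x \<in> N k" for k x
    using dist_p_N[OF that] s_pos[of k] FG(2)[of x k] hg(4)[of x k] that by (auto simp: B_def)
  moreover have "F (p k) = q k \<and> F (q k) = p k" for k
    using pq[of k] FG(2) hg(2,3) by auto
  ultimately show ?thesis using FG(1) by blast
qed

section \<open>The obstruction\<close>

text \<open>The origin, fixed by the map, is the third point in the quasisymmetry inequality: it compares
  the displacement of points near a net point \<open>y\<close> with \<open>norm y\<close>, which is
  comparable to the scale.\<close>

lemma quasisymmetric_near_identity_on_sphere:
  assumes qs: "quasisymmetric_on UNIV F"
    and F: "F 0 = 0" "\<And>k x. x \<in> N k \<Longrightarrow> F x = x"
  shows "\<exists>k. \<forall>x\<in>sphere (s k *\<^sub>R e) (s k / 4). dist (F x) x < s k / 4"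
proof -
  obtain \<eta> \<theta> :: "real \<Rightarrow> real" where hom: "homeomorphism {0..} {0..} \<eta> \<theta>"
    and eta: "\<And>x a b. x \<noteq> b \<Longrightarrow> dist (F x) (F a) / dist (F x) (F b) \<le> \<eta> (dist x a / dist x b)"
    using qs unfolding quasisymmetric_on_def by blast
  have "continuous_on {0..} \<eta>"
    using hom by (auto simp: homeomorphism_def)
  then obtain d where d: "0 < d" "\<And>t. 0 \<le> t \<Longrightarrow> t < d \<Longrightarrow> \<bar>\<eta> t\<bar> < 1/10"
    unfolding continuous_on_iff
    by (metis (no_types) atLeast_iff dist_real_def abs_of_nonneg diff_zero order_refl
        zero_less_divide_1_iff zero_less_numeral zero_of_homeomorphism_half_line[OF hom])
  \<comment> \<open>A net point within \<open>2 * mesh k\<close> of \<open>x\<close> has norm at least \<open>3/4 * s k\<close>, so the relevant ratio is at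
      most \<open>8/3 / (k + 1)\<close>. It has to be below \<open>d\<close>, and small enough for the final triangle inequality.\<close>
  obtain k :: nat where k: "8/3 / min d (1/10) < k"
    using reals_Archimedean2 by blast
  define m where "m = min d (1/10)"
  have m: "0 < m" "m \<le> d" "m \<le> 1/10" using d(1) by (auto simp: m_def)
  have mesh: "8/3 * mesh k < m * s k"
  proof -
    have "8/3 < k * m" using k m(1) by (simp add: m_def[symmetric] pos_divide_less_eq)
    also have "k * m \<le> (k + 1) * m" using m(1) by (intro mult_right_mono) auto
    finally have "8/3 * s k < (k + 1) * m * s k" using s_pos[of k] by (rule mult_strict_right_mono)
    then show ?thesis by (simp add: mesh_def pos_divide_less_eq mult_ac)
  qed
  have "dist (F x) x < s k / 4" if x: "x \<in> sphere (s k *\<^sub>R e) (s k / 4)" for x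
  proof -
    obtain y where y: "y \<in> N k" "dist x y \<le> 2 * mesh k"
      using N_dense[OF x] by blast
    have ny: "3/4 * s k \<le> norm y" "norm y \<le> 3/2 * s k"
      using norm_T[of y k] y by (auto simp: T_def)
    then have ny0: "0 < norm y" using s_pos[of k] by linarith
    have "3/4 * (m * s k) \<le> m * norm y"
      using mult_left_mono[OF ny(1), of m] m(1) by (simp add: mult_ac)
    then have "dist y x < m * norm y"
      using y(2) mesh dist_commute[of x y] by linarith
    then have "dist y x / norm y < d"
      using ny0 m(2) by (simp add: divide_less_eq) (meson less_le_trans mult_right_mono norm_ge_zero)
    then have "\<eta> (dist y x / norm y) < 1/10"
      using d(2)[of "dist y x / norm y"] by simp
    moreover have "dist y (F x) / norm y \<le> \<eta> (dist y x / norm y)"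
      using eta[of y 0 x] F y(1) ny0 by auto
    ultimately have "dist y (F x) / norm y < 1/10"
      by linarith
    then have "dist y (F x) < 1/10 * norm y"
      using ny0 by (simp add: divide_less_eq)
    moreover have "dist x y < 3/4 * (1/10) * s k"
      using y mesh mult_right_mono[OF m(3) less_imp_le[OF s_pos[of k]]] by linarith
    ultimately show ?thesis
      using ny dist_triangle[of "F x" x y] s_pos[of k] by (simp add: dist_commute)
  qed
  then show ?thesis by blast
qed

text \<open>The image of the sphere stays within distance less than \<open>s k / 2\<close> of \<open>p k\<close>, while the ray \<open>C\<close> from
  \<open>q k\<close> in the direction of \<open>e\<close> stays at distance at least \<open>s k / 2\<close>.\<close>

lemma no_quasisymmetric_extension:
  assumes qs: "quasisymmetric_on UNIV F"
    and F: "F 0 = 0" "\<And>k. F (p k) = q k" "\<And>k x. x \<in> N k \<Longrightarrow> F x = x"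
  shows False
proof -
  obtain k where k: "\<And>x. x \<in> sphere (s k *\<^sub>R e) (s k / 4) \<Longrightarrow> dist (F x) x < s k / 4"
    using quasisymmetric_near_identity_on_sphere[OF qs F(1)] F(3) by blast
  define U where "U = ball (p k) (s k / 4)"
  define C where "C = (\<lambda>t. t *\<^sub>R e) ` {3/2 * s k..}"
  have "dist (p k) x < s k / 2" if xU: "x \<in> F ` frontier U" for x
  proof -
    obtain y where y: "x = F y" "dist (p k) y = s k / 4"
      using xU s_pos[of k] by (auto simp: U_def)
    then show ?thesis
      using k[of y] dist_triangle[of "p k" "F y" y] by (simp add: p_def dist_commute)
  qed
  moreover have "s k / 2 \<le> dist (p k) x" if xC: "x \<in> C" for x
  proof -
    obtain t where t: "x = t *\<^sub>R e" "3/2 * s k \<le> t" using xC unfolding C_def by blast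
    then have "dist (p k) x = \<bar>s k - t\<bar>"
      by (simp add: p_def dist_norm norm_e flip: scaleR_left_diff_distrib)
    with t show ?thesis by linarith
  qed
  ultimately have disj: "C \<inter> F ` frontier U = {}" by force
  have "connected C"
    unfolding C_def by (intro connected_continuous_image continuous_intros connected_Ici)
  moreover have "\<not> bounded C"
  proof
    assume "bounded C"
    then obtain b where b: "\<And>x. x \<in> C \<Longrightarrow> norm x \<le> b" by (auto simp: bounded_iff)
    have "(3/2 * s k + \<bar>b\<bar>) *\<^sub>R e \<in> C" by (auto simp: C_def)
    from b[OF this] show False using s_pos[of k] by (simp add: norm_e)
  qed
  moreover obtain g where "homeomorphism UNIV (F ` UNIV) F g"
    using qs unfolding quasisymmetric_on_def by blast
  then have "continuous_on (closure U) F" "inj_on F (closure U)"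
    unfolding homeomorphism_def
    by (auto intro: continuous_on_subset) (metis UNIV_I inj_onI)
  ultimately have "C \<inter> F ` closure U = {}"
    using disj by (intro unbounded_connected_avoids_embedded_image) (auto simp: U_def)
  moreover have "p k \<in> closure U" using s_pos[of k] by (simp add: U_def)
  then have "q k \<in> F ` closure U" using F(2)[of k] by (metis image_eqI)
  moreover have "q k \<in> C" unfolding C_def q_def by (intro imageI) simp
  ultimately show False by blast
qed

end

section \<open>A bi-Lipschitz map without quasisymmetric extension\<close>

theorem theorem5p1:
  assumes "CARD('n::finite) \<ge> 2"
  shows "\<exists>(E :: (real ^ 'n) set) (f :: real ^ 'n \<Rightarrow> real ^ 'n).
           compact E \<and> countable E \<and> relatively_connected E \<and>
           bilipschitz_on E f \<and>
           (\<exists>F G. homeomorphism UNIV UNIV F G \<and> (\<forall>x\<in>E. F x = f x)) \<and>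
           \<not> (\<exists>F :: real ^ 'n \<Rightarrow> real ^ 'n. quasisymmetric_on UNIV F \<and> (\<forall>x\<in>E. F x = f x))"
proof -
  define s where "s k = (1/8::real) ^ k" for k
  obtain e :: "real ^ 'n" where e: "norm e = 1"
    using vector_choose_size[of 1] by auto
  have "\<exists>N. finite N \<and> N \<subseteq> sphere (s k *\<^sub>R e) (s k / 4) \<and> pairwise (\<lambda>x y. s k / (k + 1) \<le> dist x y) N \<and>
      (\<forall>x\<in>sphere (s k *\<^sub>R e) (s k / 4). \<exists>y\<in>N. dist x y \<le> 2 * (s k / (k + 1)))" for k
    by (rule compact_separated_net) (auto simp: s_def)
  then obtain N where N: "\<And>k. finite (N k)" "\<And>k. N k \<subseteq> sphere (s k *\<^sub>R e) (s k / 4)"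
    "\<And>k. pairwise (\<lambda>x y. s k / (k + 1) \<le> dist x y) (N k)"
    "\<And>k x. x \<in> sphere (s k *\<^sub>R e) (s k / 4) \<Longrightarrow> \<exists>y\<in>N k. dist x y \<le> 2 * (s k / (k + 1))"
    by metis
  interpret netted_spheres e s "\<lambda>k. s k / (k + 1)" N
    using assms e N by unfold_locales (auto simp: s_def)
  obtain F G where F: "homeomorphism UNIV UNIV F G" "F 0 = 0" "\<And>k. F (p k) = q k"
    "\<And>k. F (q k) = p k" "\<And>k x. x \<in> N k \<Longrightarrow> F x = x"
    using homeomorphism_swaps_exists by blast
  have "bilipschitz_on E F"
    using F by (intro bilipschitz_on_swaps) auto
  moreover have False if "quasisymmetric_on UNIV F'" "\<forall>x\<in>E. F' x = F x" for F'
    using that F by (intro no_quasisymmetric_extension[OF that(1)]) (auto simp: E_def T_def)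
  ultimately show ?thesis
    using compact_E countable_E relatively_connected_E F(1) by blast
qed

end
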